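(* Let $\mathcal{A}$ be a unitary (complex) Banach algebra, let $a\in\mathcal{A}$, let $b,c\in\mathcal{A}$ be regular, let $g\in b\{1\}$ and $h\in c\{1\}$, and suppose that $a^{-(b,c)}$ exists. Suppose that there are sequences $(a_n)_{n\ge1}$, $(b_n)_{n\ge1}$, $(g_n)_{n\ge1}$, $(c_n)_{n\ge1}$, $(h_n)_{n\ge1}$ in $\mathcal{A}$, with all $b_n$ and $c_n$ regular, such that for each $n\in\mathbb{N}$, $g_n\in b_n\{1\}$, $h_n\in c_n\{1\}$ and $a_n^{-(b_n,c_n)}$ exists, and such that $(a_n)_{n\ge1}$, $(b_ng_n)_{n\ge1}$ and $(h_nc_n)_{n\ge1}$ converge to $a$, $bg$ and $hc$, respectively. Then the following statements are equivalent. (i) There exists $k\in\mathbb{R}$ such that $\|a_n^{-(b_n,c_n)}\|\le k$ for all $n\ge1$. (ii) The sequence $(a_n^{-(b_n,c_n)})_{n\ge1}$ converges to $a^{-(b,c)}$.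
   Context: An element $x\in\mathcal{A}$ is regular if there is $w\in\mathcal{A}$ with $x=xwx$; $x\{1\}$ denotes the set of all such $w$ (inner inverses of $x$). Given $b,c\in\mathcal{A}$, the $(b,c)$-inverse $a^{-(b,c)}$ of $a\in\mathcal{A}$ is the (unique, if it exists) element $y\in\mathcal{A}$ with $y\in(b\mathcal{A}y)\cap(y\mathcal{A}c)$, $b=yab$ and $c=cay$. Convergence is in norm. *)

theory Defs
  imports Complex_Main
begin

(* Complex Banach algebras with unit. The real structure underlying the norm is the library's, and
   scaleC extends it. Only submultiplicativity of the norm is required: neither norm 1 = 1 nor
   0 ~= 1 is assumed, so every common normalization of the unit is covered. *)
class complex_banach_algebra = real_normed_algebra + monoid_mult + banach +
  fixes scaleC :: "complex \<Rightarrow> 'a \<Rightarrow> 'a"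
  assumes scaleC_add_right: "scaleC z (x + y) = scaleC z x + scaleC z y"
    and scaleC_add_left: "scaleC (z + w) x = scaleC z x + scaleC w x"
    and scaleC_scaleC: "scaleC z (scaleC w x) = scaleC (z * w) x"
    and scaleC_of_real: "scaleC (complex_of_real r) x = scaleR r x"
    and mult_scaleC_left: "scaleC z x * y = scaleC z (x * y)"
    and mult_scaleC_right: "x * scaleC z y = scaleC z (x * y)"
    and norm_scaleC: "norm (scaleC z x) = cmod z * norm x"

instantiation complex :: complex_banach_algebra
begin

definition scaleC_complex :: "complex \<Rightarrow> complex \<Rightarrow> complex" where
  "scaleC_complex z x = z * x"

instance
  by standard (simp_all add: scaleC_complex_def algebra_simps norm_mult scaleR_conv_of_real)

end

definition inner_inverses :: "'a::semigroup_mult \<Rightarrow> 'a set" where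
  "inner_inverses x = {w. x = x * w * x}"

definition regular_element :: "'a::semigroup_mult \<Rightarrow> bool" where
  "regular_element x \<longleftrightarrow> (\<exists>w. x = x * w * x)"

definition is_bc_inverse :: "'a::semigroup_mult \<Rightarrow> 'a \<Rightarrow> 'a \<Rightarrow> 'a \<Rightarrow> bool" where
  "is_bc_inverse a b c y \<longleftrightarrow>
     y \<in> {b * z * y | z. True} \<inter> {y * z * c | z. True} \<and> b = y * a * b \<and> c = c * a * y"

definition bc_invertible :: "'a::semigroup_mult \<Rightarrow> 'a \<Rightarrow> 'a \<Rightarrow> bool" where
  "bc_invertible a b c \<longleftrightarrow> (\<exists>y. is_bc_inverse a b c y)"

(* Unspecified unless bc_invertible a b c holds. *)
definition bc_inverse :: "'a::semigroup_mult \<Rightarrow> 'a \<Rightarrow> 'a \<Rightarrow> 'a" where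
  "bc_inverse a b c = (THE y. is_bc_inverse a b c y)"

lemma is_bc_inverse_unique:
  assumes "is_bc_inverse a b c x" and "is_bc_inverse a b c y"
  shows "x = y"
proof -
  obtain z where z: "x = b * z * x"
    using assms(1) unfolding is_bc_inverse_def by blast
  obtain w where w: "y = y * w * c"
    using assms(2) unfolding is_bc_inverse_def by blast
  have b: "y * a * b = b" and c: "c * a * x = c"
    using assms unfolding is_bc_inverse_def by simp_all
  have "y * a * x = y * a * b * z * x"
    by (subst z) (simp add: mult.assoc)
  also have "\<dots> = x"
    by (simp only: b z[symmetric])
  finally have 1: "y * a * x = x" .
  have "y * a * x = y * w * (c * a * x)"
    by (subst w) (simp add: mult.assoc)
  also have "\<dots> = y"
    by (simp only: c w[symmetric])
  finally show ?thesis
    using 1 by simp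
qed

lemma is_bc_inverse_bc_inverse:
  "bc_invertible a b c \<Longrightarrow> is_bc_inverse a b c (bc_inverse a b c)"
  unfolding bc_invertible_def bc_inverse_def
  by (rule theI') (blast intro: is_bc_inverse_unique)

lemma bc_inverse_eqI: "is_bc_inverse a b c y \<Longrightarrow> bc_inverse a b c = y"
  unfolding bc_inverse_def by (blast intro: is_bc_inverse_unique)

end

(* Write p = b g and q = h c.  The (b,c)-inverse y satisfies y = p y = y q, y a p = p and q a y = q,
   so b and c enter only through the idempotents p and q.  Inserting these relations into
   y' - y = y' (1 - a y) - (1 - y' a) y  makes every term carry a factor q' - q, p - p' or a' - a,
   each of which tends to 0; boundedness of the remaining factors gives convergence. *)
theory Submission
  imports Defs
begin

text \<open>Since \<open>y\<close> lies in both \<open>b * A\<close> and \<open>A * c\<close>, where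
  \<open>A\<close> is the whole algebra, it is fixed by \<open>b * g\<close> on the left, because
  \<open>b * g * b = b\<close>, and by \<open>h * c\<close> on the right, because
  \<open>c * h * c = c\<close>. The other two relations are \<open>y * a * b = b\<close> times
  \<open>g\<close> on the right and \<open>c * a * y = c\<close> times \<open>h\<close> on the
  left.\<close>

lemma is_bc_inverse_idempotents:
  assumes y: "is_bc_inverse a b c y" and g: "g \<in> inner_inverses b" and h: "h \<in> inner_inverses c"
  shows "b * g * y = y" and "y * (h * c) = y"
    and "y * a * (b * g) = b * g" and "h * c * a * y = h * c"
proof -
  obtain z w where z: "y = b * z * y" and w: "y = y * w * c"
    using y unfolding is_bc_inverse_def by blast
  have b: "y * a * b = b" and c: "c * a * y = c"
    using y unfolding is_bc_inverse_def by simp_all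
  have bgb: "b * g * b = b" and chc: "c * h * c = c"
    using g h unfolding inner_inverses_def by simp_all
  have "b * g * y = b * g * b * z * y"
    by (subst z) (simp only: mult.assoc)
  then show "b * g * y = y"
    using z bgb by simp
  have "y * (h * c) = y * w * (c * h * c)"
    by (subst w) (simp only: mult.assoc)
  then show "y * (h * c) = y"
    using w chc by simp
  show "y * a * (b * g) = b * g"
    using b by (simp flip: mult.assoc)
  show "h * c * a * y = h * c"
    using c by (simp add: mult.assoc)
qed

text \<open>The factors $1 - a y$ and $1 - y' a'$ are multiplied out because
  \<^class>\<open>complex_banach_algebra\<close> does not extend \<^class>\<open>ring_1\<close>.\<close>

lemma bc_inverse_perturbation:
  fixes a a' p p' q q' y y' :: "'a::ring"
  assumes "p * y = y" and "q * a * y = q" and "y' * q' = y'" and "y' * a' * p' = p'"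
  shows "y' - y = y' * (q' - q) - y' * ((q' - q) * (a * y))
    - ((p - p') * y - y' * (a' * ((p - p') * y))) - y' * ((a' - a) * y)"
proof -
  \<comment> \<open>The assumptions are restated in the right-nested form that products take after
    expansion with \<open>algebra_simps\<close>.\<close>
  have "q * (a * y) = q" and "y' * (q' * (a * y)) = y' * (a * y)"
    and "y' * (a' * (p' * y)) = p' * y"
    using assms by (simp_all flip: mult.assoc)
  then show ?thesis
    using assms(1,3) by (simp add: algebra_simps)
qed

lemma tendsto_of_Bfun_perturbation:
  fixes y :: "'a::real_normed_algebra" and a' p' q' y' :: "'b \<Rightarrow> 'a"
  assumes y: "p * y = y" "q * a * y = q"
    and y': "\<forall>\<^sub>F n in F. y' n * q' n = y' n" "\<forall>\<^sub>F n in F. y' n * a' n * p' n = p' n"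
    and lim: "(a' \<longlongrightarrow> a) F" "(p' \<longlongrightarrow> p) F" "(q' \<longlongrightarrow> q) F"
    and bdd: "Bfun y' F"
  shows "(y' \<longlongrightarrow> y) F"
proof -
  note Zl = bounded_linear.Zfun[OF bounded_linear_mult_left]
  note Zp = bounded_bilinear.Bfun_prod_Zfun[OF bounded_bilinear_mult]
  have Za: "Zfun (\<lambda>n. a' n - a) F" and Zq: "Zfun (\<lambda>n. q' n - q) F"
    using lim by (simp_all add: tendsto_Zfun_iff)
  have "((\<lambda>n. p - p' n) \<longlongrightarrow> p - p) F"
    by (intro tendsto_intros lim)
  then have Zpp: "Zfun (\<lambda>n. p - p' n) F"
    by (simp add: tendsto_Zfun_iff)
  \<comment> \<open>In one summand \<open>a'\<close> stands to the left of the null factor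
    \<open>p - p'\<close>, so it must be bounded; eventually it stays within distance 1 of
    \<open>a\<close>.\<close>
  have Ba: "Bfun a' F"
    unfolding Bfun_metric_def using tendstoD[OF lim(1) zero_less_one]
    by (intro exI[of _ a] exI[of _ 1]) (auto elim: eventually_mono)
  have "Zfun (\<lambda>n. y' n * (q' n - q) - y' n * ((q' n - q) * (a * y))
    - ((p - p' n) * y - y' n * (a' n * ((p - p' n) * y))) - y' n * ((a' n - a) * y)) F"
    by (intro Zfun_diff Zp[OF bdd] Zp[OF Ba] Zl Za Zq Zpp)
  moreover have "\<forall>\<^sub>F n in F. y' n - y = y' n * (q' n - q) - y' n * ((q' n - q) * (a * y))
    - ((p - p' n) * y - y' n * (a' n * ((p - p' n) * y))) - y' n * ((a' n - a) * y)"
    using y' by eventually_elim (rule bc_inverse_perturbation[OF y])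
  ultimately show ?thesis
    unfolding tendsto_Zfun_iff by (rule Zfun_ssubst[rotated])
qed

theorem theorem7p13:
  fixes a b c g h :: "'a::complex_banach_algebra"
    and an bn cn gn hn :: "nat \<Rightarrow> 'a"
  assumes "regular_element b" and "regular_element c"
    and "g \<in> inner_inverses b" and "h \<in> inner_inverses c"
    and "bc_invertible a b c"
    and "\<And>n. n \<ge> 1 \<Longrightarrow> regular_element (bn n)"
    and "\<And>n. n \<ge> 1 \<Longrightarrow> regular_element (cn n)"
    and "\<And>n. n \<ge> 1 \<Longrightarrow> gn n \<in> inner_inverses (bn n)"
    and "\<And>n. n \<ge> 1 \<Longrightarrow> hn n \<in> inner_inverses (cn n)"
    and "\<And>n. n \<ge> 1 \<Longrightarrow> bc_invertible (an n) (bn n) (cn n)"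
    and "an \<longlonglongrightarrow> a"
    and "(\<lambda>n. bn n * gn n) \<longlonglongrightarrow> b * g"
    and "(\<lambda>n. hn n * cn n) \<longlonglongrightarrow> h * c"
  shows "(\<exists>k::real. \<forall>n\<ge>1. norm (bc_inverse (an n) (bn n) (cn n)) \<le> k) \<longleftrightarrow>
         (\<lambda>n. bc_inverse (an n) (bn n) (cn n)) \<longlonglongrightarrow> bc_inverse a b c"
proof
  let ?y = "bc_inverse a b c" and ?yn = "\<lambda>n. bc_inverse (an n) (bn n) (cn n)"
  assume "\<exists>k::real. \<forall>n\<ge>1. norm (?yn n) \<le> k"
  then obtain k where "\<forall>n\<ge>1. norm (?yn n) \<le> k"
    by blast
  then have bdd: "Bfun ?yn sequentially"
    by (intro BfunI[of _ k] eventually_sequentiallyI[of 1]) simp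
  have y: "is_bc_inverse a b c ?y"
    using assms(5) by (rule is_bc_inverse_bc_inverse)
  have yn: "is_bc_inverse (an n) (bn n) (cn n) (?yn n)" if "n \<ge> 1" for n
    using assms(10)[OF that] by (rule is_bc_inverse_bc_inverse)
  \<comment> \<open>Nothing is assumed about index 0, where \<open>bc_inverse\<close> may be
    unspecified, so the relations are claimed only eventually.\<close>
  have "\<forall>\<^sub>F n in sequentially. ?yn n * (hn n * cn n) = ?yn n"
    and "\<forall>\<^sub>F n in sequentially. ?yn n * an n * (bn n * gn n) = bn n * gn n"
    using is_bc_inverse_idempotents(2,3)[OF yn assms(8) assms(9)]
    by (auto intro: eventually_sequentiallyI[of 1])
  with is_bc_inverse_idempotents(1,4)[OF y assms(3,4)] show "?yn \<longlonglongrightarrow> ?y"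
    using assms(11-13) bdd by (rule tendsto_of_Bfun_perturbation)
next
  assume "(\<lambda>n. bc_inverse (an n) (bn n) (cn n)) \<longlonglongrightarrow> bc_inverse a b c"
  then have "Bseq (\<lambda>n. bc_inverse (an n) (bn n) (cn n))"
    by (intro convergent_imp_Bseq convergentI)
  then show "\<exists>k::real. \<forall>n\<ge>1. norm (bc_inverse (an n) (bn n) (cn n)) \<le> k"
    unfolding Bseq_def by blast
qed

end
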